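(* In each stage of the Adaptive Backoff Game $G_{CW}$, in which each player $i\in\{1,\dots,N\}$ chooses its minimum contention window size $CW_{\min}$ from a convex set (interval) of positive real numbers so as to maximize its utility $$V_i(CW_{\min})=d\cdot S-l\cdot D-P_{\mathrm{Drop}},$$ there exists a unique Nash equilibrium.
   Context: Adaptive Backoff Game $G_{CW}$: the players are $N$ co-located wireless networks; the action of each player is its minimum contention window size $CW_{\min}$. A Nash equilibrium is a profile of actions such that no player can increase its own utility by unilaterally changing its action. For a given player, $p_f\in(0,1)$ is its probability of transmission failure in the current stage (measured empirically by the player and treated as a given parameter of the stage), $m$ is the maximum number of backoff stages, and $T_{\mathrm{slot}},T_{\mathrm{payload}},T_s>0$ are the durations of a time slot, of the payload and of the superframe, with $T_s=T_{\mathrm{beacon}}+T_{\mathrm{payload}}+T_{\mathrm{ack}}+T_{\mathrm{idle}}$ and $T_s>T_{\mathrm{slot}}$. The transmission probability is taken as $$\tau=\frac{1}{p_f\,CW_{\min}+1}.$$ The goodput is $$S=\frac{(1-p_f)\,\tau\,T_{\mathrm{payload}}}{\tau T_s+(1-\tau)T_{\mathrm{slot}}}.$$ The average delay is $$D=\sum_{k=1}^{m-1}\Big[p_f^{k}(1-p_f)\sum_{j=0}^{k}\Big(\frac{W_j+1}{2}T_{\mathrm{slot}}+T_s\Big)\Big]+p_f^m\sum_{j=0}^m\Big(\frac{W_j+1}{2}T_{\mathrm{slot}}+T_s\Big),$$ where the contention window sizes are $W_0=0$ and $W_j=2^jCW_{\min}$ for $j\ge1$. The packet drop probability is $P_{\mathrm{Drop}}=\tau\,p_f^{\,m+1}$.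 The numbers $d,l>0$ are weights that can be adjusted depending on the scenario.
   Formalization: Each player's interval is additionally assumed nonempty and closed, and bounded when m = 0; otherwise existence can fail, e.g. on (1,2) with m = 1 and l large the utility is strictly decreasing and has no maximizer. *)

theory Defs
  imports "HOL-Analysis.Analysis" "HOL-Library.FuncSet"
begin

text \<open>A normal-form game is given by its players \<open>I\<close>, action sets \<open>A i\<close> and
  utilities \<open>u i\<close> of action profiles. Profiles are extensional functions
  (\<open>undefined\<close> outside \<open>I\<close>), so that uniqueness of an equilibrium is meaningful.\<close>

definition nash_equilibrium ::
  "'i set \<Rightarrow> ('i \<Rightarrow> 'a set) \<Rightarrow> ('i \<Rightarrow> ('i \<Rightarrow> 'a) \<Rightarrow> real) \<Rightarrow> ('i \<Rightarrow> 'a) \<Rightarrow> bool" where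
  "nash_equilibrium I A u a \<longleftrightarrow>
     a \<in> (\<Pi>\<^sub>E i\<in>I. A i) \<and> (\<forall>i\<in>I. \<forall>x\<in>A i. u i (a(i := x)) \<le> u i a)"

record network =
  fail_prob :: real
  max_stage :: nat
  T_slot :: real
  T_beacon :: real
  T_payload :: real
  T_ack :: real
  T_idle :: real
  goodput_weight :: real
  delay_weight :: real

definition T_s :: "network \<Rightarrow> real" where
  "T_s P = T_beacon P + T_payload P + T_ack P + T_idle P"

definition valid_network :: "network \<Rightarrow> bool" where
  "valid_network P \<longleftrightarrow>
     0 < fail_prob P \<and> fail_prob P < 1 \<and>
     0 < T_slot P \<and> 0 < T_payload P \<and> 0 < T_s P \<and> T_slot P < T_s P \<and>
     0 < goodput_weight P \<and> 0 < delay_weight P"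

text \<open>In the following definitions \<open>c\<close> is the minimum contention window size.\<close>

definition tx_prob :: "network \<Rightarrow> real \<Rightarrow> real" where
  "tx_prob P c = 1 / (fail_prob P * c + 1)"

definition goodput :: "network \<Rightarrow> real \<Rightarrow> real" where
  "goodput P c =
     (1 - fail_prob P) * tx_prob P c * T_payload P /
     (tx_prob P c * T_s P + (1 - tx_prob P c) * T_slot P)"

definition window_size :: "real \<Rightarrow> nat \<Rightarrow> real" where
  "window_size c j = (if j = 0 then 0 else 2 ^ j * c)"

definition backoff_time :: "network \<Rightarrow> real \<Rightarrow> nat \<Rightarrow> real" where
  "backoff_time P c k = (\<Sum>j=0..k. (window_size c j + 1) / 2 * T_slot P + T_s P)"

definition avg_delay :: "network \<Rightarrow> real \<Rightarrow> real" where
  "avg_delay P c =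
     (\<Sum>k=1..max_stage P - 1. fail_prob P ^ k * (1 - fail_prob P) * backoff_time P c k)
     + fail_prob P ^ max_stage P * backoff_time P c (max_stage P)"

definition drop_prob :: "network \<Rightarrow> real \<Rightarrow> real" where
  "drop_prob P c = tx_prob P c * fail_prob P ^ (max_stage P + 1)"

definition utility :: "network \<Rightarrow> real \<Rightarrow> real" where
  "utility P c = goodput_weight P * goodput P c - delay_weight P * avg_delay P c - drop_prob P c"

text \<open>A stage of the Adaptive Backoff Game: the failure probability of each player is measured and
  held fixed during the stage, so the utility of player \<open>i\<close> depends on the profile only through
  the action of player \<open>i\<close>.\<close>

definition backoff_utility :: "(nat \<Rightarrow> network) \<Rightarrow> nat \<Rightarrow> (nat \<Rightarrow> real) \<Rightarrow> real" where
  "backoff_utility net i a = utility (net i) (a i)"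

end

(* Since the failure probability is fixed during a stage, the utility of a player depends on its own
   action c only, and it has the form f c = a / (r + p c) - b / (1 + p c) - (k + s c) with r > 1,
   s >= 0.  It is not concave, but it is unimodal: multiplying f' c by (r + p c)^2 gives
   b p ((r + p c) / (1 + p c))^2 - s (r + p c)^2 - a p, which is strictly decreasing because r > 1.
   So f' changes sign at most once, from + to -, and f has at most one maximizer on an interval.
   If the interval is unbounded, then s > 0 makes f tend to minus infinity. *)
theory Submission
  imports Defs
begin

text \<open>A unilateral deviation affects \<open>u i\<close> through coordinate \<open>i\<close>
  alone, so the equilibria form the product of the players' maximizer sets, here a product of
  singletons.\<close>

lemma ex1_nash_equilibrium_of_decoupled_utilities:
  assumes u: "\<And>i a. i \<in> I \<Longrightarrow> u i a = v i (a i)"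
    and ex1: "\<And>i. i \<in> I \<Longrightarrow> \<exists>!c. c \<in> A i \<and> (\<forall>x\<in>A i. v i x \<le> v i c)"
  shows "\<exists>!a. nash_equilibrium I A u a"
proof -
  define best where "best i c \<longleftrightarrow> c \<in> A i \<and> (\<forall>x\<in>A i. v i x \<le> v i c)" for i c
  have nash_iff: "nash_equilibrium I A u a \<longleftrightarrow> a \<in> (\<Pi>\<^sub>E i\<in>I. {c. best i c})" for a
    unfolding nash_equilibrium_def best_def by (auto simp: u PiE_iff)
  obtain g where g: "\<And>i. i \<in> I \<Longrightarrow> {c. best i c} = {g i}"
  proof
    fix i assume "i \<in> I"
    then have "\<exists>!c. best i c" using ex1 by (simp add: best_def)
    then show "{c. best i c} = {THE c. best i c}"
      by (metis (mono_tags, lifting) Collect_cong singleton_conv theI')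
  qed
  have "(\<Pi>\<^sub>E i\<in>I. {c. best i c}) = (\<Pi>\<^sub>E i\<in>I. {restrict g I i})"
    using g by (intro PiE_cong) auto
  \<comment> \<open>\<open>g\<close> is unconstrained outside \<open>I\<close>;
    \<open>restrict\<close> turns it into the one extensional profile in the product.\<close>
  also have "\<dots> = {restrict g I}" by (rule PiE_singleton[OF restrict_extensional])
  finally show ?thesis by (simp add: nash_iff)
qed

text \<open>Weierstrass on a compact piece of \<open>C\<close>. Cutting at \<open>max K c0\<close>
  keeps \<open>c0\<close> inside the piece, so the maximum there also dominates the values beyond
  the cut.\<close>

lemma continuous_on_attains_sup_of_eventually_le:
  fixes f :: "real \<Rightarrow> real"
  assumes "closed C" "c0 \<in> C" "C \<subseteq> {0..}" "continuous_on C f"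
    and large: "\<And>c. c \<in> C \<Longrightarrow> c > K \<Longrightarrow> f c \<le> f c0"
  shows "\<exists>c\<in>C. \<forall>x\<in>C. f x \<le> f c"
proof -
  let ?B = "C \<inter> {0..max K c0}"
  have "compact ?B" using assms(1) by (simp add: closed_Int_compact)
  moreover have c0: "c0 \<in> ?B" using assms(2,3) by auto
  moreover have "continuous_on ?B f" using assms(4) continuous_on_subset by blast
  ultimately obtain c where c: "c \<in> ?B" "\<And>x. x \<in> ?B \<Longrightarrow> f x \<le> f c"
    using continuous_attains_sup[of ?B f] by blast
  have "f x \<le> f c" if "x \<in> C" for x
  proof (cases "x \<in> ?B")
    case False
    then have "f x \<le> f c0" using large[of x] that assms(3) by auto
    then show ?thesis using c(2)[OF c0] by simp
  qed (rule c(2))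
  with c(1) show ?thesis by blast
qed

text \<open>Between two maximizers \<open>s < t\<close> the mean value theorem gives a stationary
  point \<open>z\<close>. By \<open>cross\<close>, \<open>f'\<close> is positive between
  \<open>s\<close> and \<open>z\<close>, so a second application yields \<open>f z > f s\<close>, a
  contradiction.\<close>

lemma unique_maximizer_of_single_crossing:
  fixes f f' :: "real \<Rightarrow> real"
  assumes "convex C"
    and deriv: "\<And>c. c \<in> C \<Longrightarrow> (f has_real_derivative f' c) (at c)"
    and cross: "\<And>w z. w \<in> C \<Longrightarrow> z \<in> C \<Longrightarrow> w < z \<Longrightarrow> f' z = 0 \<Longrightarrow> f' w > 0"
    and x: "x \<in> C" "\<And>c. c \<in> C \<Longrightarrow> f c \<le> f x"
    and y: "y \<in> C" "\<And>c. c \<in> C \<Longrightarrow> f c \<le> f y"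
  shows "x = y"
proof -
  have False if "s < t" and s: "s \<in> C" "\<And>c. c \<in> C \<Longrightarrow> f c \<le> f s"
    and t: "t \<in> C" "\<And>c. c \<in> C \<Longrightarrow> f c \<le> f t" for s t
  proof -
    have sub: "w \<in> C" if "s \<le> w" "w \<le> t" for w
      using \<open>convex C\<close> s(1) t(1) that by (metis is_interval_1 is_interval_convex_1)
    have "f s = f t" using s t by (simp add: antisym)
    obtain z where z: "s < z" "z < t" "f t - f s = (t - s) * f' z"
      using MVT2[OF \<open>s < t\<close>, of f f'] deriv sub by blast
    then have "f' z = 0" using \<open>s < t\<close> \<open>f s = f t\<close> by simp
    obtain w where w: "s < w" "w < z" "f z - f s = (z - s) * f' w"
      using MVT2[OF z(1), of f f'] deriv sub z(2) by (meson less_le_trans order.trans less_imp_le)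
    have "f' w > 0" using cross[of w z] sub z w \<open>f' z = 0\<close> by simp
    then have "f z > f s" using w(3) z(1) by (smt (verit) mult_pos_pos)
    with s(2)[of z] sub z show False by simp
  qed
  then show ?thesis using x y by (metis linorder_neqE_linordered_idom)
qed

lemma ex1_maximizer_of_rational_payoff:
  fixes a b p r k s :: real
  defines "f \<equiv> \<lambda>c. a / (r + p * c) - b / (1 + p * c) - (k + s * c)"
  assumes pos: "0 < p" "1 < r" "0 < b" "0 \<le> a" "0 \<le> s"
    and C: "convex C" "C \<subseteq> {0<..}" "C \<noteq> {}" "closed C" "bounded C \<or> 0 < s"
  shows "\<exists>!c. c \<in> C \<and> (\<forall>x\<in>C. f x \<le> f c)"
proof -
  define f' where "f' c = b * p / (1 + p * c)\<^sup>2 - a * p / (r + p * c)\<^sup>2 - s" for c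
  have ge1: "1 + p * c > 1" "r + p * c > 1" if "c \<in> C" for c
    using that C(2) pos by (auto simp: subset_iff add_strict_increasing2 less_add_same_cancel1)
      (metis add.right_neutral add_strict_mono mult_pos_pos)
  have deriv: "(f has_real_derivative f' c) (at c)" if "c \<in> C" for c
    unfolding f_def f'_def using ge1[OF that]
    by (auto intro!: derivative_eq_intros simp: power2_eq_square)
  have cross: "f' w > 0" if "w \<in> C" "z \<in> C" "w < z" "f' z = 0" for w z
  proof -
    define q where "q c = b * p * ((r + p * c) / (1 + p * c))\<^sup>2 - s * (r + p * c)\<^sup>2 - a * p" for c
    have q: "q c = f' c * (r + p * c)\<^sup>2" if "c \<in> C" for c
      using ge1[OF that] by (simp add: q_def f'_def field_simps)
    have pw: "p * w < p * z" using that pos by simp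
    \<comment> \<open>With \<open>c\<close> in one denominator only, \<open>1 < r\<close> makes the
      ratio visibly strictly decreasing.\<close>
    have ratio: "(r + p * c) / (1 + p * c) = 1 + (r - 1) / (1 + p * c)" if "c \<in> C" for c
      using ge1[OF that] by (simp add: field_simps)
    have "(r + p * z) / (1 + p * z) < (r + p * w) / (1 + p * w)"
      using ge1[OF that(1)] ge1[OF that(2)] pw pos(2)
      by (simp add: ratio that divide_strict_left_mono)
    then have "((r + p * z) / (1 + p * z))\<^sup>2 < ((r + p * w) / (1 + p * w))\<^sup>2"
      using ge1[OF that(2)] by (intro power_strict_mono) auto
    then have "b * p * ((r + p * z) / (1 + p * z))\<^sup>2 < b * p * ((r + p * w) / (1 + p * w))\<^sup>2"
      using pos by (intro mult_strict_left_mono) auto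
    \<comment> \<open>Only a weak inequality, as \<open>s = 0\<close> is allowed; strictness comes
      from the \<open>b * p\<close> term.\<close>
    moreover have "s * (r + p * w)\<^sup>2 \<le> s * (r + p * z)\<^sup>2"
      using pw ge1[OF that(1)] pos by (intro mult_left_mono power_mono) auto
    ultimately have "q z < q w" by (simp add: q_def)
    then have "0 < f' w * (r + p * w)\<^sup>2" using q that by simp
    then show ?thesis by (simp add: zero_less_mult_iff)
  qed
  obtain c0 where c0: "c0 \<in> C" using C(3) by blast
  have "\<exists>K. \<forall>c\<in>C. c > K \<longrightarrow> f c \<le> f c0"
  proof (cases "bounded C")
    case True
    then obtain K where "\<forall>c\<in>C. \<bar>c\<bar> \<le> K" using bounded_real by blast
    \<comment> \<open>No element of \<open>C\<close> exceeds \<open>K\<close>, so the claim is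
      vacuous.\<close>
    then show ?thesis by (intro exI[of _ K]) force
  next
    case False
    with C(5) have s: "s > 0" by simp
    \<comment> \<open>The threshold solves \<open>a - k - s * c = f c0\<close>, whose left side is
      an upper bound for \<open>f c\<close> on \<open>C\<close>.\<close>
    have "f c \<le> f c0" if c: "c \<in> C" "c > (a - k - f c0) / s" for c
    proof -
      have "a / (r + p * c) \<le> a" "0 \<le> b / (1 + p * c)"
        using ge1[OF c(1)] pos by (auto simp: divide_le_eq mult_le_cancel_left1)
      moreover have "a - k - f c0 < s * c" using c(2) s by (simp add: field_simps)
      ultimately show ?thesis unfolding f_def by linarith
    qed
    then show ?thesis by blast
  qed
  moreover have "continuous_on C f"
    using deriv DERIV_isCont continuous_at_imp_continuous_on by blast
  ultimately obtain c where c: "c \<in> C" "\<And>x. x \<in> C \<Longrightarrow> f x \<le> f c"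
    using continuous_on_attains_sup_of_eventually_le[OF C(4) c0, of f] C(2) by fastforce
  then show ?thesis
    using unique_maximizer_of_single_crossing[of C f f', OF C(1)] deriv cross
    by (intro ex1I[of _ c]) blast+
qed

text \<open>Each window size is a multiple of \<open>c\<close>. The slope sum starts at 1 because
  the window at stage 0 is 0.\<close>

lemma backoff_time_affine:
  "backoff_time P c k = backoff_time P 0 k + (T_slot P / 2 * (\<Sum>j=1..k. 2 ^ j)) * c"
proof -
  have "(\<Sum>j=0..k. window_size c j) = (\<Sum>j=1..k. 2 ^ j) * c"
    by (simp add: sum.atLeast_Suc_atMost window_size_def sum_distrib_right)
  moreover have "window_size 0 = (\<lambda>_. 0)" by (simp add: fun_eq_iff window_size_def)
  \<comment> \<open>Stated for every \<open>c\<close>, since it is applied both to the given window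
    and to 0.\<close>
  moreover have "backoff_time P c k = (\<Sum>j=0..k. window_size c j) * T_slot P / 2
      + (\<Sum>j=0..k. T_slot P / 2 + T_s P)" for c
    by (simp add: backoff_time_def sum.distrib[symmetric] sum_distrib_right sum_divide_distrib
        add_divide_distrib distrib_right del: sum.distrib sum_constant)
      (rule sum.cong; simp)
  ultimately show ?thesis by simp
qed

text \<open>The slope is a nonnegative combination of the backoff slopes. For
  \<open>1 \<le> max_stage P\<close> its last term is positive; for \<open>max_stage P = 0\<close>
  the delay is constant in \<open>c\<close>.\<close>

lemma avg_delay_affine:
  assumes "valid_network P"
  obtains s where "\<And>c. avg_delay P c = avg_delay P 0 + s * c" "0 \<le> s"
    "1 \<le> max_stage P \<Longrightarrow> 0 < s"
proof
  define p m where "p = fail_prob P" and "m = max_stage P"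
  have pos: "0 < p" "p < 1" "0 < T_slot P"
    using assms by (auto simp: valid_network_def p_def)
  define g where "g k = T_slot P / 2 * (\<Sum>j=1..k. 2 ^ j)" for k :: nat
  define s where "s = (\<Sum>k=1..m - 1. p ^ k * (1 - p) * g k) + p ^ m * g m"
  show "avg_delay P c = avg_delay P 0 + s * c" for c
    unfolding avg_delay_def backoff_time_affine[of P c] p_def[symmetric] m_def[symmetric]
      g_def[symmetric] s_def
    by (simp add: algebra_simps sum.distrib sum_distrib_left sum_subtractf)
  have g: "0 \<le> g k" for k using pos by (simp add: g_def sum_nonneg)
  have init: "0 \<le> (\<Sum>k=1..m - 1. p ^ k * (1 - p) * g k)"
    using pos g by (intro sum_nonneg mult_nonneg_nonneg) auto
  then show "0 \<le> s" using g[of m] pos by (simp add: s_def)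
  show "0 < s" if "1 \<le> max_stage P"
  proof -
    have "0 < (\<Sum>j=1..m. 2 ^ j :: real)" using that by (intro sum_pos) (auto simp: m_def)
    then have "0 < g m" using pos by (simp add: g_def)
    with pos init show ?thesis by (simp add: s_def add_nonneg_pos)
  qed
qed

text \<open>Clearing \<open>x + 1\<close> and dividing by \<open>T_slot P\<close> leaves a hyperbola
  in which \<open>c\<close> has the same coefficient as in \<open>tx_prob\<close>, with constant
  \<open>T_s P / T_slot P > 1\<close> in the role of \<open>r\<close>.\<close>

lemma goodput_eq:
  assumes "valid_network P" "0 < c"
  shows "goodput P c = (1 - fail_prob P) * T_payload P / T_slot P
    / (T_s P / T_slot P + fail_prob P * c)"
proof -
  define x where "x = fail_prob P * c"
  have pos: "0 < x" "0 < T_slot P" "0 < T_s P"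
    using assms by (auto simp: valid_network_def x_def)
  have tx: "tx_prob P c = 1 / (x + 1)" by (simp add: tx_prob_def x_def)
  have "1 - tx_prob P c = x / (x + 1)" using pos by (simp add: tx field_simps)
  then have denom: "tx_prob P c * T_s P + (1 - tx_prob P c) * T_slot P
      = (T_s P + x * T_slot P) / (x + 1)"
    by (simp add: tx add_divide_distrib)
  have "goodput P c = (1 - fail_prob P) * T_payload P / (T_s P + x * T_slot P)"
    using pos unfolding goodput_def denom by (simp add: tx)
  also have "T_s P + x * T_slot P = T_slot P * (T_s P / T_slot P + x)"
    using pos by (simp add: field_simps)
  finally show ?thesis by (simp add: x_def)
qed

lemma ex1_utility_maximizer:
  assumes P: "valid_network P"
    and C: "convex C" "C \<subseteq> {0<..}" "C \<noteq> {}" "closed C" "bounded C \<or> 1 \<le> max_stage P"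
  shows "\<exists>!c. c \<in> C \<and> (\<forall>x\<in>C. utility P x \<le> utility P c)"
proof -
  define p where "p = fail_prob P"
  obtain s where s: "\<And>c. avg_delay P c = avg_delay P 0 + s * c" "0 \<le> s"
    "1 \<le> max_stage P \<Longrightarrow> 0 < s"
    using avg_delay_affine[OF P] by blast
  have pos: "0 < p" "p < 1" "0 < T_slot P" "0 < T_payload P" "T_slot P < T_s P"
    "0 < goodput_weight P" "0 < delay_weight P"
    using P by (auto simp: valid_network_def p_def)
  define a where "a = goodput_weight P * ((1 - p) * T_payload P / T_slot P)"
  define f where "f c = a / (T_s P / T_slot P + p * c) - p ^ (max_stage P + 1) / (1 + p * c)
      - (delay_weight P * avg_delay P 0 + delay_weight P * s * c)" for c
  \<comment> \<open>The closed form of the goodput needs \<open>0 < c\<close>, so the identity is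
    claimed on \<open>C\<close> only, which suffices for comparing values there.\<close>
  have eq: "utility P c = f c" if "c \<in> C" for c
  proof -
    have "0 < c" using that C(2) by auto
    then show ?thesis
      unfolding utility_def goodput_eq[OF P \<open>0 < c\<close>] s(1)[of c] drop_prob_def tx_prob_def f_def
        a_def p_def[symmetric]
      by (simp add: algebra_simps)
  qed
  have "\<exists>!c. c \<in> C \<and> (\<forall>x\<in>C. f x \<le> f c)"
    unfolding f_def
    by (rule ex1_maximizer_of_rational_payoff) (use pos s C in \<open>auto simp: a_def\<close>)
  then show ?thesis using eq by (metis (no_types, lifting))
qed

text \<open>Closedness, and boundedness or a positive delay slope, secure existence of best
  responses: with \<open>max_stage\<close> 0 and an unbounded interval, a small goodput weight can
  make the utility increase forever without attaining its supremum.\<close>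

theorem theorem8:
  fixes N :: nat
    and net :: "nat \<Rightarrow> network"
    and CW :: "nat \<Rightarrow> real set"
  assumes "\<And>i. i \<in> {1..N} \<Longrightarrow> valid_network (net i)"
    and "\<And>i. i \<in> {1..N} \<Longrightarrow> convex (CW i)"
    and "\<And>i. i \<in> {1..N} \<Longrightarrow> CW i \<subseteq> {0<..}"
    and "\<And>i. i \<in> {1..N} \<Longrightarrow> CW i \<noteq> {}"
    and "\<And>i. i \<in> {1..N} \<Longrightarrow> closed (CW i)"
    and "\<And>i. i \<in> {1..N} \<Longrightarrow> bounded (CW i) \<or> 1 \<le> max_stage (net i)"
  shows "\<exists>!a. nash_equilibrium {1..N} CW (backoff_utility net) a"
proof (rule ex1_nash_equilibrium_of_decoupled_utilities)
  show "backoff_utility net i a = utility (net i) (a i)" for i a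
    by (simp add: backoff_utility_def)
qed (rule ex1_utility_maximizer; rule assms)

end
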